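(* Let $G$ be a finite multigraph whose underlying simple graph is not a complete graph. Then $$\mu_2(G) \le \kappa(G)\, m(G).$$
   Context: A multigraph may have multiple edges but has no loops. The underlying simple graph of a multigraph $G$ has the same vertex set, with two distinct vertices adjacent iff at least one edge of $G$ joins them (the one-vertex graph counts as complete). For vertices $u,v$, $m(u,v)$ is the number of edges with endpoints $u$ and $v$, and $m(G)=\max m(u,v)$ over all adjacent pairs $u,v$ (with $m(G)=0$ if $G$ has no edges). The adjacency matrix $A(G)$ has $(i,j)$ entry equal to the number of edges with endpoints $v_i,v_j$, where $V(G)=\{v_1,\dots,v_n\}$; the Laplacian matrix is $D(G)-A(G)$, where $D(G)$ is the diagonal matrix of vertex degrees (edges counted with multiplicity). $\mu_i(G)$ is the $i$-th smallest eigenvalue of the Laplacian matrix, counted with multiplicity. $G$ is $k$-vertex-connected if $G$ has more than $k$ vertices and every subgraph obtained by deleting fewer than $k$ vertices is connected; the vertex-connectivity $\kappa(G)$ is the maximum $k$ such that $G$ is $k$-vertex-connected. *)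

theory Defs
  imports "Jordan_Normal_Form.Char_Poly"
begin

text \<open>Finite loopless multigraphs. Edges are labels in their own right, so parallel edges are
  distinct labels with the same set of endpoints; a set of endpoints of cardinality 2 excludes
  loops.\<close>

record ('v, 'e) multigraph =
  verts :: "'v set"
  edges :: "'e set"
  ends :: "'e \<Rightarrow> 'v set"

locale finite_multigraph =
  fixes G :: "('v, 'e) multigraph"
  assumes finite_verts: "finite (verts G)"
    and verts_nonempty: "verts G \<noteq> {}"
    and finite_edges: "finite (edges G)"
    and ends_in_verts: "\<And>e. e \<in> edges G \<Longrightarrow> ends G e \<subseteq> verts G"
    and card_ends: "\<And>e. e \<in> edges G \<Longrightarrow> card (ends G e) = 2"

definition multiplicity_between :: "('v, 'e) multigraph \<Rightarrow> 'v \<Rightarrow> 'v \<Rightarrow> nat" where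
  "multiplicity_between G u v = card {e \<in> edges G. ends G e = {u, v}}"

definition adjacent :: "('v, 'e) multigraph \<Rightarrow> 'v \<Rightarrow> 'v \<Rightarrow> bool" where
  "adjacent G u v \<longleftrightarrow> u \<noteq> v \<and> (\<exists>e \<in> edges G. ends G e = {u, v})"

definition max_multiplicity :: "('v, 'e) multigraph \<Rightarrow> nat" where
  "max_multiplicity G =
     (if edges G = {} then 0
      else Max {multiplicity_between G u v | u v.
                  u \<in> verts G \<and> v \<in> verts G \<and> adjacent G u v})"

text \<open>The edges of the underlying simple graph are the two-element sets of adjacent vertices
  themselves, so that no two of them are parallel.\<close>

definition underlying_simple_graph :: "('v, 'e) multigraph \<Rightarrow> ('v, 'v set) multigraph" where
  "underlying_simple_graph G =
     \<lparr>verts = verts G,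
      edges = {{u, v} | u v. u \<in> verts G \<and> v \<in> verts G \<and> adjacent G u v},
      ends = (\<lambda>e. e)\<rparr>"

definition complete_graph :: "('v, 'e) multigraph \<Rightarrow> bool" where
  "complete_graph G \<longleftrightarrow> (\<forall>u \<in> verts G. \<forall>v \<in> verts G. u \<noteq> v \<longrightarrow> adjacent G u v)"

definition delete_vertices :: "('v, 'e) multigraph \<Rightarrow> 'v set \<Rightarrow> ('v, 'e) multigraph" where
  "delete_vertices G S =
     G\<lparr>verts := verts G - S, edges := {e \<in> edges G. ends G e \<inter> S = {}}\<rparr>"

definition connected_graph :: "('v, 'e) multigraph \<Rightarrow> bool" where
  "connected_graph G \<longleftrightarrow>
     verts G \<noteq> {} \<and> (\<forall>u \<in> verts G. \<forall>v \<in> verts G. (adjacent G)\<^sup>*\<^sup>* u v)"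

definition vertex_connected :: "nat \<Rightarrow> ('v, 'e) multigraph \<Rightarrow> bool" where
  "vertex_connected k G \<longleftrightarrow>
     card (verts G) > k \<and>
     (\<forall>S \<subseteq> verts G. card S < k \<longrightarrow> connected_graph (delete_vertices G S))"

text \<open>The maximum is over a finite set containing 0, as \<open>vertex_connected k G\<close> bounds \<open>k\<close> by the
  number of vertices and a nonempty graph is vacuously 0-connected.\<close>

definition vertex_connectivity :: "('v, 'e) multigraph \<Rightarrow> nat" where
  "vertex_connectivity G = Max {k. vertex_connected k G}"

definition vertex_degree :: "('v, 'e) multigraph \<Rightarrow> 'v \<Rightarrow> nat" where
  "vertex_degree G v = card {e \<in> edges G. v \<in> ends G e}"

text \<open>In the following matrices the list \<open>vs\<close> is an enumeration of the vertices, without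
  repetition; position \<open>i\<close> (from 0) holds the vertex of row and column \<open>i\<close>.\<close>

definition adjacency_matrix :: "'v list \<Rightarrow> ('v, 'e) multigraph \<Rightarrow> real mat" where
  "adjacency_matrix vs G =
     mat (length vs) (length vs) (\<lambda>(i, j). real (multiplicity_between G (vs ! i) (vs ! j)))"

definition degree_matrix :: "'v list \<Rightarrow> ('v, 'e) multigraph \<Rightarrow> real mat" where
  "degree_matrix vs G =
     mat (length vs) (length vs) (\<lambda>(i, j). if i = j then real (vertex_degree G (vs ! i)) else 0)"

definition laplacian_matrix :: "'v list \<Rightarrow> ('v, 'e) multigraph \<Rightarrow> real mat" where
  "laplacian_matrix vs G = degree_matrix vs G - adjacency_matrix vs G"

text \<open>Eigenvalues are repeated according to their multiplicity as roots of the characteristic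
  polynomial. The Laplacian matrix is real symmetric, so all of its eigenvalues are real and
  the list has one entry per vertex. The index \<open>i\<close> starts at 1.\<close>

definition laplacian_eigenvalue :: "'v list \<Rightarrow> ('v, 'e) multigraph \<Rightarrow> nat \<Rightarrow> real" where
  "laplacian_eigenvalue vs G i =
     sorted_list_of_multiset (proots (char_poly (laplacian_matrix vs G))) ! (i - 1)"

end

theory Submission
  imports Defs "Jordan_Normal_Form.Schur_Decomposition"
begin

text \<open>If \<open>S\<close> separates the remaining vertices into nonempty parts \<open>A\<close> and \<open>B\<close>, then on the plane
  spanned by the indicator vectors of \<open>A\<close> and \<open>B\<close> only the edges into \<open>S\<close> contribute to the
  Laplacian quadratic form. Hence the form is at most \<open>|S| m(G)\<close> times the squared norm on a
  plane, and by the min-max principle so is the second smallest eigenvalue. Since the underlying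
  graph is not complete, some such \<open>S\<close> has at most \<open>\<kappa>(G)\<close> elements.\<close>

section \<open>Spectral theorem for real symmetric matrices and a two-dimensional min-max
  bound\<close>

lemma conjugate_real_vec [simp]: "conjugate (v :: real vec) = v"
  by (rule eq_vecI) (auto simp: conjugate_vec_def)

text \<open>Over the complex numbers the polynomial splits. A root \<open>a\<close> with eigenvector
  \<open>v\<close> is real: moving the real symmetric matrix across the Hermitian product turns
  \<open>a * (v \<bullet>c v)\<close> into \<open>cnj a * (v \<bullet>c v)\<close>, and
  \<open>v \<bullet>c v\<close> is nonzero.\<close>

lemma char_poly_real_symmetric_splits:
  fixes A :: "real mat"
  assumes A: "A \<in> carrier_mat n n" and sym: "transpose_mat A = A"
  shows "\<exists>es. char_poly A = (\<Prod>e\<leftarrow>es. [:- e, 1:]) \<and> length es = n"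
proof -
  let ?C = "map_mat complex_of_real A"
  have C: "?C \<in> carrier_mat n n" using A by auto
  interpret h: map_poly_inj_idom_hom complex_of_real ..
  have cp: "char_poly ?C = map_poly complex_of_real (char_poly A)"
    by (rule of_real_hom.char_poly_hom[OF A])
  obtain as where as: "char_poly ?C = (\<Prod>a\<leftarrow>as. [:- a, 1:])" "length as = n"
    using char_poly_factorized[OF C] by blast
  have real: "a = of_real (Re a)" if "a \<in> set as" for a
  proof -
    have "poly (char_poly ?C) a = 0"
      using that unfolding as(1) poly_prod_list prod_list_zero_iff by force
    then have "eigenvalue ?C a"
      using eigenvalue_root_char_poly[OF C] by blast
    then obtain v where v: "v \<in> carrier_vec n" "v \<noteq> 0\<^sub>v n" and ev: "?C *\<^sub>v v = a \<cdot>\<^sub>v v"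
      using A unfolding eigenvalue_def eigenvector_def by auto
    have cC: "conjugate ((?C *\<^sub>v v)) = ?C *\<^sub>v conjugate v"
      using A v by (intro eq_vecI) (auto simp: scalar_prod_def intro!: sum.cong)
    have CT: "transpose_mat ?C = ?C"
      using arg_cong[OF sym, of "map_mat complex_of_real"]
      by (metis map_mat_transpose)
    have "a * (v \<bullet>c v) = (?C *\<^sub>v v) \<bullet>c v"
      unfolding ev using v by simp
    also have "\<dots> = v \<bullet> (?C *\<^sub>v conjugate v)"
      using transpose_vec_mult_scalar[OF C, of "conjugate v" v] v unfolding CT by simp
    also have "\<dots> = v \<bullet> conjugate (a \<cdot>\<^sub>v v)"
      unfolding ev[symmetric] cC ..
    also have "\<dots> = cnj a * (v \<bullet>c v)"
      using v by (simp add: conjugate_smult_vec)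
    finally have "a = cnj a"
      using v conjugate_square_eq_0_vec[OF v(1)] by simp
    then show ?thesis
      by (metis Reals_cnj_iff of_real_Re)
  qed
  let ?es = "map Re as"
  have "map_poly complex_of_real (char_poly A) = (\<Prod>a\<leftarrow>as. [:- of_real (Re a), 1:])"
    unfolding cp[symmetric] as(1) using real by (intro arg_cong[of _ _ prod_list] map_cong) auto
  also have "\<dots> = map_poly complex_of_real (\<Prod>e\<leftarrow>?es. [:- e, 1:])"
    by (simp add: h.hom_prod_list o_def)
  \<comment> \<open>The embedding of real polynomials into complex ones is injective, so the
    factorization descends.\<close>
  finally have "char_poly A = (\<Prod>e\<leftarrow>?es. [:- e, 1:])" by simp
  then show ?thesis using as(2) by (intro exI[of _ ?es]) simp
qed

text \<open>Gram-Schmidt, run on a basis that starts with \<open>v\<close>, leaves its first vector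
  unchanged; normalizing afterwards only rescales it. The unspecified scalar \<open>c\<close> does
  no harm to an eigenvector equation.\<close>

lemma orthonormal_completion:
  fixes v :: "real vec"
  assumes v: "v \<in> carrier_vec n" "v \<noteq> 0\<^sub>v n"
  shows "\<exists>W \<in> carrier_mat n n. \<exists>c. transpose_mat W * W = 1\<^sub>m n \<and> col W 0 = c \<cdot>\<^sub>v v"
proof -
  have n: "n \<noteq> 0"
    using v by (metis carrier_vecD eq_vecI index_zero_vec(2) not_less_zero)
  interpret cof_vec_space n "TYPE(real)" .
  note b = basis_completion[OF v]
  define ws where "ws = gram_schmidt n (basis_completion v)"
  note ws = gram_schmidt_result[OF b(2) b(4) b(5) ws_def]
  have len: "length ws = n" using ws(4) b(6) by simp
  have wsn: "ws ! i \<in> carrier_vec n" if "i < n" for i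
    using ws(3) len that by auto
  have hd: "ws ! 0 = v"
  proof -
    obtain us where "basis_completion v = v # us"
      using b(6,7) n by (cases "basis_completion v") auto
    then have "hd ws = v"
      using gram_schmidt_hd[OF v(1), of us] by (simp add: ws_def)
    then show ?thesis using len n by (metis hd_conv_nth length_0_conv)
  qed
  define N where "N i = sqrt (ws ! i \<bullet> ws ! i)" for i
  define W where "W = mat n n (\<lambda>(i, j). ws ! j $ i / N j)"
  have W: "W \<in> carrier_mat n n" by (simp add: W_def)
  have col: "col W j = (1 / N j) \<cdot>\<^sub>v ws ! j" if "j < n" for j
    using that wsn[OF that] by (intro eq_vecI) (auto simp: W_def)
  have "transpose_mat W * W = 1\<^sub>m n"
  proof (rule eq_matI)
    fix i j assume "i < dim_row (1\<^sub>m n :: real mat)" "j < dim_col (1\<^sub>m n :: real mat)"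
    then have ij: "i < n" "j < n" by auto
    have "(transpose_mat W * W) $$ (i, j) = col W i \<bullet> col W j"
      using ij W by simp
    also have "\<dots> = (ws ! i \<bullet> ws ! j) / (N i * N j)"
      using ij wsn[OF ij(1)] wsn[OF ij(2)] by (simp add: col)
    also have "\<dots> = (if i = j then 1 else 0)"
    proof (cases "i = j")
      case True
      \<comment> \<open>Orthogonality in the sense of \<open>corthogonalD\<close> includes that no
        vector is isotropic. Its conjugates disappear over the reals by
        \<open>conjugate_real_vec\<close>.\<close>
      have "ws ! i \<bullet> ws ! i \<noteq> 0"
        using corthogonalD[OF ws(2), of i i] ij len by simp
      moreover have "ws ! i \<bullet> ws ! i \<ge> 0"
        by (auto simp: scalar_prod_def intro: sum_nonneg)
      ultimately show ?thesis using True by (simp add: N_def)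
    next
      case False
      then show ?thesis using corthogonalD[OF ws(2), of i j] ij len by simp
    qed
    finally show "(transpose_mat W * W) $$ (i, j) = 1\<^sub>m n $$ (i, j)" using ij by simp
  qed (use W in auto)
  then show ?thesis using W col[of 0] n hd by auto
qed

text \<open>Deflation by induction on \<open>es\<close>: an orthogonal change of basis splits off
  one eigenvector for the head, and the complementary block is again symmetric, with the tail as its
  eigenvalues. The diagonal follows the given order of \<open>es\<close>, so an increasing order may
  be chosen later.\<close>

lemma real_symmetric_diagonalizable:
  fixes A :: "real mat"
  assumes "A \<in> carrier_mat n n" and "transpose_mat A = A"
    and "char_poly A = (\<Prod>e\<leftarrow>es. [:- e, 1:])"
  shows "\<exists>Q \<in> carrier_mat n n. transpose_mat Q * Q = 1\<^sub>m n \<and>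
           transpose_mat Q * A * Q = mat_diag n (\<lambda>i. es ! i)"
  using assms
proof (induct es arbitrary: n A)
  case Nil
  then have "n = 0" using degree_monic_char_poly[of A n] by simp
  then show ?case using Nil by (intro bexI[of _ "1\<^sub>m n"]) (auto intro!: eq_matI simp: mat_diag_def)
next
  case (Cons e es n A)
  note A = Cons(2) and sym = Cons(3)
  have "degree (char_poly A) = Suc (length es)"
    unfolding Cons(4) using degree_linear_factors[of uminus "e # es"] by simp
  then obtain m where n: "n = Suc m" 
    using degree_monic_char_poly[OF A] by auto
  have "eigenvalue A e"
    unfolding eigenvalue_root_char_poly[OF A] Cons(4) by simp
  then obtain v where v: "v \<in> carrier_vec n" "v \<noteq> 0\<^sub>v n" and ev: "A *\<^sub>v v = e \<cdot>\<^sub>v v"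
    using A unfolding eigenvalue_def eigenvector_def by auto
  obtain W c where W: "W \<in> carrier_mat n n" and WW: "transpose_mat W * W = 1\<^sub>m n"
    and W0: "col W 0 = c \<cdot>\<^sub>v v"
    using orthonormal_completion[OF v] by blast
  define W' where "W' = transpose_mat W"
  have W': "W' \<in> carrier_mat n n" using W by (simp add: W'_def)
  note WW = WW[folded W'_def]
  have WW': "W * W' = 1\<^sub>m n" by (rule mat_mult_left_right_inverse[OF W' W WW])
  define A' where "A' = W' * A * W"
  have A': "A' \<in> carrier_mat n n" using A W W' by (simp add: A'_def)
  have sim: "similar_mat A' A"
    unfolding similar_mat_def
    by (intro exI, rule similar_mat_witI[of _ _ n, OF WW WW' A'_def A' A W' W])
  have sym': "transpose_mat A' = A'"
  proof -
    have "transpose_mat A' = transpose_mat W * transpose_mat (W' * A)"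
      unfolding A'_def by (rule transpose_mult[of _ n n _ n]) (use W' A W in auto)
    also have "transpose_mat (W' * A) = transpose_mat A * transpose_mat W'"
      by (rule transpose_mult[OF W' A])
    finally show ?thesis
      unfolding A'_def sym using A W W' by (simp add: W'_def assoc_mult_mat[of _ n n _ n _ n])
  qed
  \<comment> \<open>Column 0 of \<open>W\<close> is an eigenvector for \<open>e\<close>, and
    \<open>W'\<close> sends it back to the first unit vector.\<close>
  have col0: "col A' 0 = e \<cdot>\<^sub>v col (1\<^sub>m n) 0"
  proof -
    have "col A' 0 = col (W' * (A * W)) 0"
      using A W W' by (simp add: A'_def assoc_mult_mat[of _ n n _ n _ n])
    also have "\<dots> = W' *\<^sub>v col (A * W) 0"
      using A W W' n by (intro col_mult2[of _ n n _ n]) auto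
    also have "col (A * W) 0 = A *\<^sub>v col W 0"
      using A W n by (intro col_mult2[of _ n n _ n]) auto
    also have "A *\<^sub>v col W 0 = e \<cdot>\<^sub>v col W 0"
      unfolding W0 using A v ev
      by (simp add: mult_mat_vec[of _ n n] smult_smult_assoc mult.commute)
    also have "W' *\<^sub>v (e \<cdot>\<^sub>v col W 0) = e \<cdot>\<^sub>v (W' *\<^sub>v col W 0)"
      using W W' by (intro mult_mat_vec) auto
    also have "W' *\<^sub>v col W 0 = col (W' * W) 0"
      using W W' n by (intro col_mult2[of _ n n _ n, symmetric]) auto
    finally show ?thesis by (simp only: WW)
  qed
  have Ai0: "A' $$ (i, 0) = (if i = 0 then e else 0)" if "i < n" for i
    using arg_cong[OF col0, of "\<lambda>v. v $ i"] A' that n by auto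
  \<comment> \<open>Symmetry carries the zeros of column 0 over to row 0, which makes
    \<open>A'\<close> block diagonal.\<close>
  have A0i: "A' $$ (0, i) = (if i = 0 then e else 0)" if "i < n" for i
    using Ai0[OF that] arg_cong[OF sym', of "\<lambda>M. M $$ (i, 0)"] A' that n by auto
  define D where "D = mat m m (\<lambda>(i, j). A' $$ (Suc i, Suc j))"
  define E where "E = mat 1 1 (\<lambda>_. e)"
  have D: "D \<in> carrier_mat m m" and E: "E \<in> carrier_mat 1 1" by (simp_all add: D_def E_def)
  have block: "A' = four_block_mat E (0\<^sub>m 1 m) (0\<^sub>m m 1) D"
    using A' by (intro eq_matI) (auto simp: D_def E_def n Ai0 A0i)
  have symD: "transpose_mat D = D"
  proof (rule eq_matI)
    fix i j assume "i < dim_row D" "j < dim_col D"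
    then show "transpose_mat D $$ (i, j) = D $$ (i, j)"
      using arg_cong[OF sym', of "\<lambda>M. M $$ (Suc i, Suc j)"] A' n by (auto simp: D_def)
  qed (auto simp: D_def)
  \<comment> \<open>Cancelling the linear factor of \<open>e\<close> leaves the tail of the list for
    \<open>D\<close>, as the induction hypothesis requires.\<close>
  have "[:- e, 1:] * char_poly D = char_poly A'"
    unfolding block char_poly_four_block_zeros_col[OF E zero_carrier_mat D]
    by (simp add: E_def char_poly_defs det_def sign_def)
  also have "\<dots> = [:- e, 1:] * (\<Prod>e\<leftarrow>es. [:- e, 1:])"
    unfolding char_poly_similar[OF sim] Cons(4) by simp
  finally have "char_poly D = (\<Prod>e\<leftarrow>es. [:- e, 1:])"
    by (metis mult_cancel_left pCons_eq_0_iff zero_neq_one)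
  then obtain R where R: "R \<in> carrier_mat m m" and RR: "transpose_mat R * R = 1\<^sub>m m"
    and RD: "transpose_mat R * D * R = mat_diag m (\<lambda>i. es ! i)"
    using Cons(1)[OF D symD] by blast
  \<comment> \<open>Bordering \<open>R\<close> with a 1 keeps the entry \<open>e\<close> fixed while
    diagonalizing \<open>D\<close>; the total change of basis is \<open>W * P\<close>.\<close>
  define P where "P = four_block_mat (1\<^sub>m 1) (0\<^sub>m 1 m) (0\<^sub>m m 1) R"
  define P' where "P' = four_block_mat (1\<^sub>m 1) (0\<^sub>m 1 m) (0\<^sub>m m 1) (transpose_mat R)"
  have P: "P \<in> carrier_mat n n" and P': "P' \<in> carrier_mat n n"
    using R by (auto simp: P_def P'_def n)
  have PT: "transpose_mat P = P'"
    unfolding P_def P'_def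
    by (subst transpose_four_block_mat[of _ 1 1 _ m _ m]) (use R in auto)
  have PP: "P' * P = 1\<^sub>m n"
    unfolding P_def P'_def
    by (subst mult_four_block_mat[of _ 1 1 _ m _ m _ _ 1 _ m]) (use R in \<open>auto simp: RR n\<close>)
  have "P' * A' = four_block_mat E (0\<^sub>m 1 m) (0\<^sub>m m 1) (transpose_mat R * D)"
    unfolding P'_def block
    by (subst mult_four_block_mat[of _ 1 1 _ m _ m _ _ 1 _ m]) (use R E D in auto)
  then have "P' * A' * P = four_block_mat E (0\<^sub>m 1 m) (0\<^sub>m m 1) (transpose_mat R * D * R)"
    unfolding P_def
    by (simp, subst mult_four_block_mat[of _ 1 1 _ m _ m _ _ 1 _ m]) (use R E D in auto)
  also have "\<dots> = mat_diag n (\<lambda>i. (e # es) ! i)"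
    unfolding RD by (intro eq_matI) (auto simp: mat_diag_def E_def n nth_Cons')
  finally have PAP: "P' * A' * P = mat_diag n (\<lambda>i. (e # es) ! i)" .
  have QT: "transpose_mat (W * P) = P' * W'"
    using transpose_mult[OF W P] by (simp add: PT W'_def)
  have "P' * W' * (W * P) = P' * (W' * W) * P"
    using P P' W W' by (simp add: assoc_mult_mat[of _ n n _ n _ n])
  then have 1: "P' * W' * (W * P) = 1\<^sub>m n"
    using P P' by (simp add: WW PP)
  have 2: "P' * W' * A * (W * P) = P' * A' * P"
    unfolding A'_def using A P P' W W' by (simp add: assoc_mult_mat[of _ n n _ n _ n])
  show ?case
    using P W by (intro bexI[of _ "W * P"]) (auto simp: QT 1 2 PAP)
qed

text \<open>The span of \<open>x\<close> and \<open>y\<close> has dimension two, so it contains a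
  nonzero vector orthogonal to an eigenvector of the smallest eigenvalue. On that vector the form
  involves only the remaining eigenvalues; if the second one exceeded \<open>c\<close>, then so
  would all of these, against \<open>quad\<close>.\<close>

lemma second_eigenvalue_le:
  fixes A :: "real mat"
  assumes A: "A \<in> carrier_mat n n" and sym: "transpose_mat A = A" and n: "2 \<le> n"
    and x: "x \<in> carrier_vec n" and y: "y \<in> carrier_vec n"
    and indep: "\<And>a b. a \<cdot>\<^sub>v x + b \<cdot>\<^sub>v y = 0\<^sub>v n \<Longrightarrow> a = 0 \<and> b = 0"
    and quad: "\<And>a b. (a \<cdot>\<^sub>v x + b \<cdot>\<^sub>v y) \<bullet> (A *\<^sub>v (a \<cdot>\<^sub>v x + b \<cdot>\<^sub>v y))
                 \<le> c * ((a \<cdot>\<^sub>v x + b \<cdot>\<^sub>v y) \<bullet> (a \<cdot>\<^sub>v x + b \<cdot>\<^sub>v y))"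
  shows "sorted_list_of_multiset (proots (char_poly A)) ! 1 \<le> c"
proof (rule ccontr)
  define es where "es = sorted_list_of_multiset (proots (char_poly A))"
  assume "\<not> ?thesis"
  then have gt: "c < es ! 1" by (simp add: es_def)
  obtain fs where fs: "char_poly A = (\<Prod>e\<leftarrow>fs. [:- e, 1:])" "length fs = n"
    using char_poly_real_symmetric_splits[OF A sym] by blast
  have "proots (\<Prod>e\<leftarrow>gs. [:- e, 1:]) = mset gs" for gs :: "real list"
  proof (induct gs)
    case (Cons g gs)
    have "(\<Prod>e\<leftarrow>gs. [:- e, 1:]) \<noteq> 0" by (auto simp: prod_list_zero_iff)
    then have "proots ([:- g, 1:] * (\<Prod>e\<leftarrow>gs. [:- e, 1:])) = proots [:- g, 1:] + mset gs"
      using Cons by (subst proots_mult) auto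
    then show ?case by simp
  qed simp
  \<comment> \<open>The sorted list of roots is a permutation of \<open>fs\<close>, so it factors
    the characteristic polynomial too and can serve as the diagonal.\<close>
  then have mset: "mset es = mset fs"
    unfolding es_def fs(1) by simp
  then have "char_poly A = (\<Prod>e\<leftarrow>es. [:- e, 1:])"
    unfolding fs(1) by (metis mset_map prod_mset_prod_list)
  then obtain Q where Q: "Q \<in> carrier_mat n n" and QQ: "transpose_mat Q * Q = 1\<^sub>m n"
    and QAQ: "transpose_mat Q * A * Q = mat_diag n (\<lambda>i. es ! i)"
    using real_symmetric_diagonalizable[OF A sym] by blast
  define R where "R = transpose_mat Q"
  have R: "R \<in> carrier_mat n n" using Q by (simp add: R_def)
  have QR: "Q * R = 1\<^sub>m n"
    using mat_mult_left_right_inverse[OF R Q] QQ by (simp add: R_def)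
  have sorted: "sorted es" and len: "length es = n"
    using fs(2) mset by (simp add: es_def, metis size_mset)
  \<comment> \<open>a combination of \<open>x\<close> and \<open>y\<close> orthogonal to the eigenvector of the smallest eigenvalue\<close>
  obtain a b where ab: "a * (R *\<^sub>v x) $ 0 + b * (R *\<^sub>v y) $ 0 = 0" "a \<noteq> 0 \<or> b \<noteq> 0"
  proof (cases "(R *\<^sub>v x) $ 0 = 0")
    case True
    then show ?thesis using that[of 1 0] by simp
  next
    case False
    then show ?thesis using that[of "- (R *\<^sub>v y) $ 0" "(R *\<^sub>v x) $ 0"] by simp
  qed
  define z where "z = a \<cdot>\<^sub>v x + b \<cdot>\<^sub>v y"
  define w where "w = R *\<^sub>v z"
  have z: "z \<in> carrier_vec n" and w: "w \<in> carrier_vec n"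
    using x y R by (auto simp: z_def w_def)
  have z0: "z \<noteq> 0\<^sub>v n" using indep[of a b] ab(2) by (auto simp: z_def)
  have zw: "z = Q *\<^sub>v w"
    using z Q R by (simp add: w_def QR flip: assoc_mult_mat_vec[of _ n n _ n])
  have w0: "w $ 0 = 0"
  proof -
    have "w = a \<cdot>\<^sub>v (R *\<^sub>v x) + b \<cdot>\<^sub>v (R *\<^sub>v y)"
      unfolding w_def z_def using x y R
      by (simp add: mult_add_distrib_mat_vec[of _ n n] mult_mat_vec[of _ n n])
    then show ?thesis using ab(1) n R by simp
  qed
  have "w \<noteq> 0\<^sub>v n"
    using z0 zw Q by (auto simp: zero_mat_def)
  then obtain k where k: "k < n" "w $ k \<noteq> 0"
    using w by (metis carrier_vecD eq_vecI index_zero_vec)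
  \<comment> \<open>Used twice: \<open>M = A\<close> gives the diagonal form in the coordinates
    \<open>w\<close>, and the identity matrix gives the squared norm.\<close>
  have form: "z \<bullet> (M *\<^sub>v z) = w \<bullet> ((R * M * Q) *\<^sub>v w)" if M: "M \<in> carrier_mat n n" for M
  proof -
    have Mz: "M *\<^sub>v z \<in> carrier_vec n" using M z by simp
    have "z \<bullet> (M *\<^sub>v z) = (R *\<^sub>v (M *\<^sub>v z)) \<bullet> w"
      using transpose_vec_mult_scalar[OF Q w Mz] comm_scalar_prod[OF z Mz]
      by (simp add: R_def zw)
    also have "\<dots> = w \<bullet> (R *\<^sub>v (M *\<^sub>v z))"
      using w R Mz by (intro comm_scalar_prod) auto
    also have "R *\<^sub>v (M *\<^sub>v z) = (R * M * Q) *\<^sub>v w"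
      unfolding zw using w R M Q by (simp add: assoc_mult_mat_vec[of _ n n _ n])
    finally show ?thesis .
  qed
  have diag: "w \<bullet> (mat_diag n d *\<^sub>v w) = (\<Sum>i<n. d i * (w $ i)\<^sup>2)" for d
  proof -
    have "(mat_diag n d *\<^sub>v w) $ i = d i * w $ i" if "i < n" for i
      using that w
      by (simp add: mat_diag_def scalar_prod_def if_distrib[of "\<lambda>c. c * _"] cong: if_cong)
    then show ?thesis
      using w by (auto simp: scalar_prod_def mat_diag_def power2_eq_square lessThan_atLeast0
          algebra_simps intro!: sum.cong)
  qed
  have "z \<bullet> (A *\<^sub>v z) = (\<Sum>i<n. es ! i * (w $ i)\<^sup>2)"
    unfolding form[OF A] using QAQ diag by (simp add: R_def)
  moreover have "z \<bullet> z = (\<Sum>i<n. (w $ i)\<^sup>2)"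
    using form[of "1\<^sub>m n"] diag[of "\<lambda>_. 1"] z R QQ by (simp add: R_def)
  \<comment> \<open>Coordinate 0 vanishes, and at every other position the eigenvalue is at least
    \<open>es ! 1\<close>, hence above \<open>c\<close>. The nonzero coordinate \<open>k\<close>
    makes the inequality strict.\<close>
  moreover have "c * (\<Sum>i<n. (w $ i)\<^sup>2) < (\<Sum>i<n. es ! i * (w $ i)\<^sup>2)"
    unfolding sum_distrib_left
  proof (rule sum_strict_mono_ex1)
    have ge: "c < es ! i" if "i < n" "i \<noteq> 0" for i
      using sorted_nth_mono[OF sorted, of 1 i] that len gt by simp
    show "\<forall>i\<in>{..<n}. c * (w $ i)\<^sup>2 \<le> es ! i * (w $ i)\<^sup>2"
    proof
      fix i assume "i \<in> {..<n}"
      then show "c * (w $ i)\<^sup>2 \<le> es ! i * (w $ i)\<^sup>2"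
        using ge[of i] w0 by (cases "i = 0") (auto intro: mult_right_mono)
    qed
    show "\<exists>i\<in>{..<n}. c * (w $ i)\<^sup>2 < es ! i * (w $ i)\<^sup>2"
      using k ge[of k] w0 by (intro bexI[of _ k]) (auto intro!: mult_strict_right_mono)
  qed simp
  ultimately show False using quad[of a b] unfolding z_def[symmetric] by simp
qed

section \<open>Multigraphs: multiplicities, degrees and vertex separators\<close>

lemma adjacent_sym: "adjacent G u v \<Longrightarrow> adjacent G v u"
  by (auto simp: adjacent_def insert_commute)

lemma adjacent_underlying_simple_graph:
  "adjacent (underlying_simple_graph G) u v \<longleftrightarrow>
     u \<in> verts G \<and> v \<in> verts G \<and> adjacent G u v"
proof -
  have "adjacent (underlying_simple_graph G) u v \<longleftrightarrow>
      u \<noteq> v \<and> (\<exists>x y. {u, v} = {x, y} \<and> x \<in> verts G \<and> y \<in> verts G \<and> adjacent G x y)"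
    unfolding adjacent_def[of "underlying_simple_graph G"] by (auto simp: underlying_simple_graph_def)
  also have "\<dots> \<longleftrightarrow> u \<in> verts G \<and> v \<in> verts G \<and> adjacent G u v"
    using adjacent_sym[of G] unfolding doubleton_eq_iff by (metis adjacent_def)
  finally show ?thesis .
qed

lemma complete_graph_underlying_simple_graph:
  "complete_graph (underlying_simple_graph G) \<longleftrightarrow> complete_graph G"
  by (auto simp: complete_graph_def adjacent_underlying_simple_graph)
    (auto simp: underlying_simple_graph_def)

context finite_multigraph
begin

lemma multiplicity_eq_0_iff: "multiplicity_between G u v = 0 \<longleftrightarrow> \<not> adjacent G u v"
proof -
  have "u \<noteq> v" if "e \<in> edges G" "ends G e = {u, v}" for e
    using card_ends[OF that(1)] that(2) by (auto simp: card_insert_if)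
  then show ?thesis
    using finite_edges by (auto simp: multiplicity_between_def adjacent_def)
qed

lemma multiplicity_le_max:
  assumes "u \<in> verts G" "v \<in> verts G"
  shows "multiplicity_between G u v \<le> max_multiplicity G"
proof (cases "adjacent G u v")
  case True
  let ?M = "{multiplicity_between G u v | u v. u \<in> verts G \<and> v \<in> verts G \<and> adjacent G u v}"
  have "?M \<subseteq> (\<lambda>(u, v). multiplicity_between G u v) ` (verts G \<times> verts G)" by auto
  then have "finite ?M" using finite_verts by (meson finite_SigmaI finite_imageI finite_subset)
  then have "multiplicity_between G u v \<le> Max ?M" using True assms by (intro Max_ge) auto
  moreover have "edges G \<noteq> {}" using True by (auto simp: adjacent_def)
  ultimately show ?thesis by (simp add: max_multiplicity_def)
next
  case False
  then show ?thesis using multiplicity_eq_0_iff[of u v] by simp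
qed

text \<open>Every edge at \<open>u\<close> has exactly one other endpoint, so these edges are
  partitioned by it; absence of loops makes the class of \<open>u\<close> itself empty.\<close>

lemma vertex_degree_eq_sum:
  assumes "u \<in> verts G"
  shows "vertex_degree G u = (\<Sum>v\<in>verts G. multiplicity_between G u v)"
proof -
  have "\<exists>v\<in>verts G. ends G e = {u, v}" if "e \<in> edges G" "u \<in> ends G e" for e
    using card_ends[OF that(1)] ends_in_verts[OF that(1)] that(2)
    by (auto simp: card_2_iff insert_commute)
  then have "{e \<in> edges G. u \<in> ends G e} = (\<Union>v\<in>verts G. {e \<in> edges G. ends G e = {u, v}})"
    by auto
  then show ?thesis
    unfolding vertex_degree_def multiplicity_between_def
    using finite_verts finite_edges
    by (simp, subst card_UN_disjoint) (auto simp: doubleton_eq_iff)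
qed

text \<open>The admissible \<open>k\<close> are bounded by the number of vertices, so the maximum is
  a true upper bound. The failure one step above it is what produces a small separator.\<close>

lemma not_vertex_connected_Suc: "\<not> vertex_connected (Suc (vertex_connectivity G)) G"
proof
  assume *: "vertex_connected (Suc (vertex_connectivity G)) G"
  have "{k. vertex_connected k G} \<subseteq> {..card (verts G)}"
    by (auto simp: vertex_connected_def)
  then have "finite {k. vertex_connected k G}" by (rule finite_subset) simp
  then have "Suc (vertex_connectivity G) \<le> vertex_connectivity G"
    using * unfolding vertex_connectivity_def by (intro Max_ge) auto
  then show False by simp
qed

text \<open>Connectivity one step above the maximum can fail in two ways. If there are too few
  vertices, all vertices other than some nonadjacent pair separate that pair; this is where
  noncompleteness enters. Otherwise some small set disconnects the graph.\<close>

lemma separator_exists: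
  assumes "\<not> complete_graph G"
  shows "\<exists>S A B. verts G = S \<union> A \<union> B \<and> S \<inter> A = {} \<and> S \<inter> B = {} \<and> A \<inter> B = {} \<and>
           A \<noteq> {} \<and> B \<noteq> {} \<and> card S \<le> vertex_connectivity G \<and>
           (\<forall>u\<in>A. \<forall>v\<in>B. \<not> adjacent G u v)"
proof -
  obtain p q where pq: "p \<in> verts G" "q \<in> verts G" "p \<noteq> q" "\<not> adjacent G p q"
    using assms by (auto simp: complete_graph_def)
  have cpq: "card (verts G - {p, q}) = card (verts G) - 2"
    using pq finite_verts by (simp add: card_Diff_subset)
  show ?thesis
  proof (cases "card (verts G) \<le> Suc (vertex_connectivity G)")
    case True
    then show ?thesis
      using pq cpq by (intro exI[of _ "verts G - {p, q}"] exI[of _ "{p}"] exI[of _ "{q}"]) auto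
  next
    case False
    then obtain S where S: "S \<subseteq> verts G" "card S \<le> vertex_connectivity G"
      and disc: "\<not> connected_graph (delete_vertices G S)"
      using not_vertex_connected_Suc by (auto simp: vertex_connected_def less_Suc_eq_le)
    let ?H = "delete_vertices G S"
    have V: "verts ?H = verts G - S" by (simp add: delete_vertices_def)
    \<comment> \<open>By cardinality some vertices survive, so the disconnection is not due to an
      empty vertex set and yields two mutually unreachable vertices.\<close>
    have "verts G - S \<noteq> {}"
      using S False by (metis Diff_eq_empty_iff le_SucI subset_antisym)
    then obtain u v where uv: "u \<in> verts G - S" "v \<in> verts G - S" "\<not> (adjacent ?H)\<^sup>*\<^sup>* u v"
      using disc by (auto simp: connected_graph_def V)
    \<comment> \<open>The component of \<open>u\<close> after deletion. An edge from it to another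
      remaining vertex avoids \<open>S\<close>, hence survives and would extend a path from
      \<open>u\<close>.\<close>
    define A where "A = {w \<in> verts G - S. (adjacent ?H)\<^sup>*\<^sup>* u w}"
    have "\<not> adjacent G x y" if x: "x \<in> A" and y: "y \<in> verts G - S - A" for x y
    proof
      assume "adjacent G x y"
      then have "adjacent ?H x y"
        using x y by (auto simp: adjacent_def delete_vertices_def A_def)
      then have "(adjacent ?H)\<^sup>*\<^sup>* u y"
        using x by (auto simp: A_def intro: rtranclp.rtrancl_into_rtrancl)
      then show False using y by (auto simp: A_def)
    qed
    moreover have "u \<in> A" "v \<in> verts G - S - A" using uv by (auto simp: A_def)
    ultimately show ?thesis
      using S by (intro exI[of _ S] exI[of _ A] exI[of _ "verts G - S - A"]) (auto simp: A_def)
  qed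
qed

section \<open>The quadratic form of the Laplacian\<close>

lemma laplacian_form:
  fixes f :: "'v \<Rightarrow> real"
  assumes vs: "distinct vs" "set vs = verts G"
  defines "x \<equiv> vec (length vs) (\<lambda>i. f (vs ! i))"
  shows "x \<bullet> (laplacian_matrix vs G *\<^sub>v x) =
    (\<Sum>u\<in>verts G. \<Sum>v\<in>verts G. real (multiplicity_between G u v) * ((f u)\<^sup>2 - f u * f v))"
proof -
  let ?n = "length vs" and ?L = "laplacian_matrix vs G"
  let ?m = "\<lambda>u v. real (multiplicity_between G u v)"
  have reindex: "(\<Sum>i<?n. g (vs ! i)) = (\<Sum>u\<in>verts G. g u)" for g :: "'v \<Rightarrow> real"
    using bij_betw_nth[OF vs(1) refl vs(2)[symmetric]] by (rule sum.reindex_bij_betw)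
  have row: "(?L *\<^sub>v x) $ i = (\<Sum>v\<in>verts G. ?m (vs ! i) v * (f (vs ! i) - f v))"
    if i: "i < ?n" for i
  proof -
    have "(?L *\<^sub>v x) $ i =
        (\<Sum>j<?n. (if j = i then real (vertex_degree G (vs ! i)) * f (vs ! i) else 0)
                 - ?m (vs ! i) (vs ! j) * f (vs ! j))"
      using i by (auto simp: laplacian_matrix_def degree_matrix_def adjacency_matrix_def
          scalar_prod_def x_def lessThan_atLeast0 algebra_simps intro!: sum.cong)
    also have "\<dots> = real (vertex_degree G (vs ! i)) * f (vs ! i)
                    - (\<Sum>v\<in>verts G. ?m (vs ! i) v * f v)"
      using i reindex[of "\<lambda>v. ?m (vs ! i) v * f v"] by (simp add: sum_subtractf)
    \<comment> \<open>Writing the degree as a sum of multiplicities merges the diagonal with the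
      rest of the row into weighted differences.\<close>
    also have "\<dots> = (\<Sum>v\<in>verts G. ?m (vs ! i) v * (f (vs ! i) - f v))"
      using i vs(2) nth_mem[OF i]
      by (simp add: vertex_degree_eq_sum sum_distrib_right sum_subtractf right_diff_distrib)
    finally show ?thesis .
  qed
  have "x \<bullet> (?L *\<^sub>v x) = (\<Sum>i<?n. f (vs ! i) * (\<Sum>v\<in>verts G. ?m (vs ! i) v * (f (vs ! i) - f v)))"
    using row by (auto simp: scalar_prod_def x_def lessThan_atLeast0 laplacian_matrix_def
        adjacency_matrix_def intro!: sum.cong)
  also have "\<dots> = (\<Sum>u\<in>verts G. f u * (\<Sum>v\<in>verts G. ?m u v * (f u - f v)))"
    by (rule reindex)
  finally show ?thesis
    by (simp add: sum_distrib_left power2_eq_square algebra_simps)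
qed

text \<open>The bound holds for each ordered pair. If \<open>v\<close> lies outside
  \<open>S\<close>, the term vanishes: \<open>u\<close> is in \<open>S\<close> and
  \<open>f u = 0\<close>, or both lie in the same part and \<open>f u = f v\<close>, or they lie in
  opposite parts and no edge joins them. If \<open>v\<close> lies in \<open>S\<close>, then
  \<open>f v = 0\<close> and the term is at most m(G) times the square of \<open>f u\<close>; there
  are \<open>card S\<close> such \<open>v\<close> for each \<open>u\<close>.\<close>

lemma laplacian_form_le:
  fixes f :: "'v \<Rightarrow> real"
  assumes vs: "distinct vs" "set vs = verts G"
    and V: "verts G = S \<union> A \<union> B"
    and sep: "\<And>u v. u \<in> A \<Longrightarrow> v \<in> B \<Longrightarrow> \<not> adjacent G u v"
    and f: "\<And>v. v \<in> S \<Longrightarrow> f v = 0" "\<And>v. v \<in> A \<Longrightarrow> f v = a" "\<And>v. v \<in> B \<Longrightarrow> f v = b"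
  defines "x \<equiv> vec (length vs) (\<lambda>i. f (vs ! i))"
  shows "x \<bullet> (laplacian_matrix vs G *\<^sub>v x)
    \<le> real (card S) * real (max_multiplicity G) * (x \<bullet> x)"
proof -
  let ?m = "\<lambda>u v. real (multiplicity_between G u v)" and ?M = "real (max_multiplicity G)"
  have fin: "finite S" using V finite_verts by simp
  have term_le: "?m u v * ((f u)\<^sup>2 - f u * f v) \<le> (if v \<in> S then ?M * (f u)\<^sup>2 else 0)"
    if u: "u \<in> verts G" and v: "v \<in> verts G" for u v
  proof (cases "v \<in> S")
    case True
    then show ?thesis using multiplicity_le_max[OF u v] f(1) by (simp add: mult_right_mono)
  next
    case False
    consider "f u = 0" | "f u = f v" | "\<not> adjacent G u v"
      using u v False V f sep adjacent_sym by (metis UnE)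
    then show ?thesis
      using False multiplicity_eq_0_iff[of u v] by cases (auto simp: power2_eq_square)
  qed
  have xx: "x \<bullet> x = (\<Sum>u\<in>verts G. (f u)\<^sup>2)"
  proof -
    have "x \<bullet> x = (\<Sum>i<length vs. (f (vs ! i))\<^sup>2)"
      by (simp add: scalar_prod_def x_def lessThan_atLeast0 power2_eq_square)
    also have "\<dots> = (\<Sum>u\<in>verts G. (f u)\<^sup>2)"
      using bij_betw_nth[OF vs(1) refl vs(2)[symmetric]] by (rule sum.reindex_bij_betw)
    finally show ?thesis .
  qed
  have "x \<bullet> (laplacian_matrix vs G *\<^sub>v x) \<le> (\<Sum>u\<in>verts G. \<Sum>v\<in>verts G. if v \<in> S then ?M * (f u)\<^sup>2 else 0)"
    unfolding x_def laplacian_form[OF vs] by (intro sum_mono term_le)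
  also have "\<dots> = (\<Sum>u\<in>verts G. real (card S) * ?M * (f u)\<^sup>2)"
  proof (rule sum.cong)
    fix u
    have "verts G \<inter> S = S" using V by auto
    then show "(\<Sum>v\<in>verts G. if v \<in> S then ?M * (f u)\<^sup>2 else 0) = real (card S) * ?M * (f u)\<^sup>2"
      using finite_verts by (simp add: sum.If_cases)
  qed simp
  finally show ?thesis unfolding xx by (simp add: sum_distrib_left)
qed

lemma transpose_laplacian: "transpose_mat (laplacian_matrix vs G) = laplacian_matrix vs G"
  by (rule eq_matI) (auto simp: laplacian_matrix_def degree_matrix_def adjacency_matrix_def
      multiplicity_between_def insert_commute)

end

section \<open>From a separator to the eigenvalue bound\<close>

theorem theorem1p1:
  fixes G :: "('v, 'e) multigraph" and vs :: "'v list"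
  assumes "finite_multigraph G"
    and "\<not> complete_graph (underlying_simple_graph G)"
    and "distinct vs" and "set vs = verts G"
  shows "laplacian_eigenvalue vs G 2
           \<le> real (vertex_connectivity G) * real (max_multiplicity G)"
proof -
  interpret finite_multigraph G by fact
  note vs = assms(3,4)
  obtain S A B where V: "verts G = S \<union> A \<union> B"
    and disj: "S \<inter> A = {}" "S \<inter> B = {}" "A \<inter> B = {}" and ne: "A \<noteq> {}" "B \<noteq> {}"
    and S: "card S \<le> vertex_connectivity G" and sep: "\<And>u v. u \<in> A \<Longrightarrow> v \<in> B \<Longrightarrow> \<not> adjacent G u v"
    using separator_exists assms(2) by (metis complete_graph_underlying_simple_graph)
  let ?n = "length vs" and ?L = "laplacian_matrix vs G"
  let ?c = "real (card S) * real (max_multiplicity G)"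
  define ind where "ind X = vec ?n (\<lambda>i. if vs ! i \<in> X then 1 else 0 :: real)" for X
  \<comment> \<open>The vertex function behind
    \<open>a \<cdot>\<^sub>v ind A + b \<cdot>\<^sub>v ind B\<close>: constant on each part and 0 on
    \<open>S\<close>.\<close>
  define f where "f a b = (\<lambda>v. if v \<in> A then a else if v \<in> B then b else 0 :: real)" for a b
  have comb: "a \<cdot>\<^sub>v ind A + b \<cdot>\<^sub>v ind B = vec ?n (\<lambda>i. f a b (vs ! i))" for a b
    using disj by (intro eq_vecI) (auto simp: ind_def f_def)
  obtain i j where i: "i < ?n" "vs ! i \<in> A" and j: "j < ?n" "vs ! j \<in> B"
    using ne V vs(2) by (metis UnCI all_not_in_conv in_set_conv_nth)
  have "i \<noteq> j" using i j disj by auto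
  \<comment> \<open>Both parts contribute a position, so a second eigenvalue exists.\<close>
  then have n: "2 \<le> ?n" using i(1) j(1) by linarith
  have "sorted_list_of_multiset (proots (char_poly ?L)) ! 1 \<le> ?c"
  proof (rule second_eigenvalue_le[OF _ transpose_laplacian n, where x = "ind A" and y = "ind B"])
    show "?L \<in> carrier_mat ?n ?n"
      by (simp add: laplacian_matrix_def adjacency_matrix_def degree_matrix_def minus_carrier_mat)
    show "a = 0 \<and> b = 0" if "a \<cdot>\<^sub>v ind A + b \<cdot>\<^sub>v ind B = 0\<^sub>v ?n" for a b
    proof -
      \<comment> \<open>Reading the combination at the positions \<open>i\<close> in
        \<open>A\<close> and \<open>j\<close> in \<open>B\<close> isolates \<open>a\<close> and
        \<open>b\<close>.\<close>
      have "f a b (vs ! k) = 0" if "k < ?n" for k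
        using arg_cong[OF \<open>a \<cdot>\<^sub>v ind A + b \<cdot>\<^sub>v ind B = 0\<^sub>v ?n\<close>, of "\<lambda>x. x $ k"] that
        by (simp add: comb)
      from this[OF i(1)] this[OF j(1)] show ?thesis
        using i j disj by (auto simp: f_def split: if_splits)
    qed
    show "(a \<cdot>\<^sub>v ind A + b \<cdot>\<^sub>v ind B) \<bullet> (?L *\<^sub>v (a \<cdot>\<^sub>v ind A + b \<cdot>\<^sub>v ind B))
        \<le> ?c * ((a \<cdot>\<^sub>v ind A + b \<cdot>\<^sub>v ind B) \<bullet> (a \<cdot>\<^sub>v ind A + b \<cdot>\<^sub>v ind B))" for a b
      unfolding comb
      by (rule laplacian_form_le[OF vs V sep, where a = a and b = b])
        (use disj in \<open>auto simp: f_def\<close>)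
  qed (simp_all add: ind_def)
  also have "?c \<le> real (vertex_connectivity G) * real (max_multiplicity G)"
    using S by (intro mult_right_mono) auto
  \<comment> \<open>Eigenvalue 2, counted from 1, is position 1 of the sorted list.\<close>
  finally show ?thesis by (simp add: laplacian_eigenvalue_def)
qed

end
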